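(* Let $X$ be a non-negative random variable with absolutely continuous distribution, and for an integer $n\ge 1$ let $X_{1:n}$ be the minimum of $n$ i.i.d. copies of $X$. If $X$ is IPEX, then $X_{1:n}$ is also IPEX.
   Context: For a non-negative random variable $Z$ with density $g$ and distribution function $H$, the past extropy at $t$ is $$\widetilde{\mathfrak{J}}(Z;t)=-\frac12\int_0^t\left[\frac{g(u)}{H(t)}\right]^2du,$$ considered for those $t$ with $H(t)>0$; $Z$ is IPEX (increasing past extropy) if $\widetilde{\mathfrak{J}}(Z;t)$ is (non-strictly) increasing in $t>0$. *)

theory Defs
  imports "HOL-Probability.Probability"
begin

definition nonneg_abs_cont :: "'a measure \<Rightarrow> ('a \<Rightarrow> real) \<Rightarrow> bool" where
  "nonneg_abs_cont M Z \<longleftrightarrow>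
     Z \<in> borel_measurable M \<and> (AE \<omega> in M. 0 \<le> Z \<omega>) \<and>
     absolutely_continuous lborel (distr M borel Z)"

text \<open>The density of \<open>Z\<close> is the Radon-Nikodym derivative of its law with respect to Lebesgue measure.
  It is only determined almost everywhere, which does not affect the integral.  The value is an
  extended real: if the squared density is not integrable on \<open>[0, t]\<close>, the past extropy
  at \<open>t\<close> is \<open>-\<infinity>\<close>.\<close>

definition past_extropy :: "'a measure \<Rightarrow> ('a \<Rightarrow> real) \<Rightarrow> real \<Rightarrow> ereal" where
  "past_extropy M Z t =
     - ereal (1 / 2) * enn2ereal
       (\<integral>\<^sup>+ u \<in> {0..t}. (RN_deriv lborel (distr M borel Z) u
                            / ennreal (cdf (distr M borel Z) t))\<^sup>2 \<partial>lborel)"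

definition IPEX :: "'a measure \<Rightarrow> ('a \<Rightarrow> real) \<Rightarrow> bool" where
  "IPEX M Z \<longleftrightarrow>
     nonneg_abs_cont M Z \<and>
     mono_on {t. 0 < t \<and> 0 < cdf (distr M borel Z) t} (past_extropy M Z)"

end

theory Submission
  imports Defs
begin

text \<open>
  Let \<open>F\<close> and \<open>f\<close> be the distribution function and density of \<open>X\<close>.  The minimum has distribution
  function \<open>G = 1 - (1 - F)^n\<close> and density \<open>g = v f\<close> with \<open>v = n (1 - F)^(n-1)\<close>.  Up to the factor
  \<open>-1/2\<close> the past extropies are \<open>I(t) / F(t)^2\<close> and \<open>J(t) / G(t)^2\<close>, where \<open>I(t)\<close> and \<open>J(t)\<close> are the
  integrals of \<open>f^2\<close> and \<open>g^2 = v^2 f^2\<close> over \<open>[0, t]\<close>; the task is to pass from the monotonicity of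
  the first quotient to that of the second.

  Two monotone functions make this work: the likelihood ratio \<open>v = g / f\<close>, and the ratio of reversed
  hazard rates \<open>r = (g / G) / (f / F) = F v / G\<close>, which is \<open>n y^(n-1) / (1 + y + ... + y^(n-1))\<close> at
  \<open>y = 1 - F\<close>.  Both decrease along the line.

  Fix \<open>s < t\<close> and put \<open>h = I(s) / F(s)^2\<close>.  Since \<open>I / F^2\<close> decreases, the measure \<open>f^2 dx\<close> gives
  at least as much mass as \<open>h d(F^2)\<close> to every interval \<open>[0, u]\<close> with \<open>u \<le> s\<close>, and at most as much to
  every interval \<open>[s, u]\<close>.  A decreasing weight is a mixture of indicators of initial intervals, so
  integrating the weight \<open>v^2\<close> preserves both comparisons
  (lemma \<open>nn_integral_mono_antimono_weight\<close>).  Because \<open>v^2 d(F^2) = r d(G^2)\<close> and \<open>r\<close>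
  decreases, the constant \<open>c = h r(s)\<close> satisfies
    \<open>J(s) \<ge> c G(s)^2\<close>   and   \<open>J(t) - J(s) \<le> c (G(t)^2 - G(s)^2)\<close>,
  and these two bounds together give \<open>J(t) / G(t)^2 \<le> J(s) / G(s)^2\<close>
  (lemma \<open>past_square_ratio_transfer\<close>).  If \<open>h\<close> is infinite, then so is \<open>J(s)\<close>, because \<open>v\<close> is bounded
  away from 0 near the left end of the support.

  The distribution function is differentiable only almost everywhere, so the identities
  \<open>d(F^2) = 2 F f dx\<close>, \<open>d(G^2) = 2 G g dx\<close> and \<open>dG = v f dx\<close> are obtained from the quantile
  transform rather than by differentiation (lemma \<open>nn_integral_atomless_cdf\<close>).
\<close>

section \<open>Decreasing weights on an interval\<close>

lemma borel_measurable_antimono: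
  fixes w :: "real \<Rightarrow> real"
  assumes "antimono w"
  shows "w \<in> borel_measurable borel"
proof -
  have "mono (\<lambda>x. - w x)"
    using assms by (simp add: monotone_def)
  then have "(\<lambda>x. - (- w x)) \<in> borel_measurable borel"
    by (intro borel_measurable_uminus borel_measurable_mono)
  then show ?thesis
    by simp
qed

text \<open>
  Layer-cake argument: the positive part of \<open>w\<close> is the integral over \<open>y \<ge> 0\<close> of the indicators of
  the level sets \<open>{w \<ge> y}\<close>, and each of these meets \<open>[a, b]\<close> in the empty set or in an interval starting
  at \<open>a\<close>, on which the hypothesis compares \<open>p\<close> and \<open>q\<close>.
\<close>
lemma nn_integral_mono_antimono_weight:
  fixes p q :: "real \<Rightarrow> ennreal" and w :: "real \<Rightarrow> real"
  assumes [measurable]: "p \<in> borel_measurable borel" "q \<in> borel_measurable borel"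
    and anti: "antimono w"
    and le: "\<And>u. a \<le> u \<Longrightarrow> u \<le> b \<Longrightarrow> (\<integral>\<^sup>+x\<in>{a..u}. p x \<partial>lborel) \<le> (\<integral>\<^sup>+x\<in>{a..u}. q x \<partial>lborel)"
  shows "(\<integral>\<^sup>+x\<in>{a..b}. ennreal (w x) * p x \<partial>lborel) \<le> (\<integral>\<^sup>+x\<in>{a..b}. ennreal (w x) * q x \<partial>lborel)"
proof -
  have [measurable]: "w \<in> borel_measurable borel"
    using anti by (rule borel_measurable_antimono)
  define T where "T y = {x \<in> {a..b}. y \<le> w x}" for y
  have layer: "(\<integral>\<^sup>+x\<in>{a..b}. ennreal (w x) * g x \<partial>lborel)
      = (\<integral>\<^sup>+y\<in>{0..}. (\<integral>\<^sup>+x\<in>T y. g x \<partial>lborel) \<partial>lborel)"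
    if [measurable]: "g \<in> borel_measurable borel" for g :: "real \<Rightarrow> ennreal"
  proof -
    have "(\<integral>\<^sup>+x\<in>{a..b}. ennreal (w x) * g x \<partial>lborel)
        = (\<integral>\<^sup>+x. \<integral>\<^sup>+y. g x * indicator {a..b} x * indicator {0..w x} y \<partial>lborel \<partial>lborel)"
    proof (intro nn_integral_cong)
      fix x :: real
      have "emeasure lborel {0..w x} = ennreal (w x)"
        by (cases "0 \<le> w x") (auto simp: ennreal_neg)
      then show "ennreal (w x) * g x * indicator {a..b} x
          = (\<integral>\<^sup>+y. g x * indicator {a..b} x * indicator {0..w x} y \<partial>lborel)"
        by (subst nn_integral_cmult_indicator) (auto simp: ac_simps)
    qed
    also have "\<dots> = (\<integral>\<^sup>+x. \<integral>\<^sup>+y. g x * indicator {a..b} x * indicator {z. 0 \<le> snd z \<and> snd z \<le> w (fst z)} (x, y) \<partial>lborel \<partial>lborel)"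
      by (intro nn_integral_cong) (auto simp: indicator_def)
    also have "\<dots> = (\<integral>\<^sup>+y. \<integral>\<^sup>+x. g x * indicator {a..b} x * indicator {z. 0 \<le> snd z \<and> snd z \<le> w (fst z)} (x, y) \<partial>lborel \<partial>lborel)"
      by (rule lborel_pair.Fubini') measurable
    also have "\<dots> = (\<integral>\<^sup>+y. (\<integral>\<^sup>+x. g x * indicator (T y) x * indicator {0..} y \<partial>lborel) \<partial>lborel)"
      by (intro nn_integral_cong) (auto simp: indicator_def T_def)
    also have "\<dots> = (\<integral>\<^sup>+y\<in>{0..}. (\<integral>\<^sup>+x\<in>T y. g x \<partial>lborel) \<partial>lborel)"
      by (intro nn_integral_cong nn_integral_multc) (simp add: T_def)
    finally show ?thesis .
  qed
  have levels: "(\<integral>\<^sup>+x\<in>T y. p x \<partial>lborel) \<le> (\<integral>\<^sup>+x\<in>T y. q x \<partial>lborel)" for y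
  proof (cases "T y = {}")
    case False
    define u where "u = Sup (T y)"
    have bdd: "bdd_above (T y)"
      by (auto simp: T_def)
    obtain z where z: "z \<in> T y"
      using False by auto
    have u: "a \<le> u" "u \<le> b"
      using z cSup_upper[OF z bdd] cSup_least[OF False, of b] by (auto simp: u_def T_def)
    have below: "x \<in> T y" if x: "a \<le> x" "x < u" for x
    proof -
      obtain x' where x': "x' \<in> T y" "x < x'"
        using less_cSup_iff[OF False bdd] x(2) unfolding u_def by auto
      then have "w x' \<le> w x"
        by (intro antimonoD[OF anti]) simp
      then show ?thesis
        using x' x(1) x'(1) by (auto simp: T_def)
    qed
    have above: "x \<in> {a..u}" if "x \<in> T y" for x
      using cSup_upper[OF that bdd] that by (simp add: u_def T_def)
    \<comment> \<open>The level set agrees with \<open>{a..u}\<close> except possibly at the null set \<open>{u}\<close>.\<close>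
    have "(\<integral>\<^sup>+x\<in>T y. g x \<partial>lborel) = (\<integral>\<^sup>+x\<in>{a..u}. g x \<partial>lborel)" for g :: "real \<Rightarrow> ennreal"
    proof (rule nn_integral_cong_AE)
      show "AE x in lborel. g x * indicator (T y) x = g x * indicator {a..u} x"
        using AE_lborel_singleton[of u]
      proof eventually_elim
        case (elim x)
        then have "x \<in> T y \<longleftrightarrow> x \<in> {a..u}"
          using below[of x] above[of x] by auto
        then show ?case
          by (simp add: indicator_def)
      qed
    qed
    then show ?thesis
      using le[OF u] by simp
  qed simp
  show ?thesis
    unfolding layer[OF assms(1)] layer[OF assms(2)]
    by (intro levels mult_right_mono nn_integral_mono) simp
qed

lemma nn_integral_Icc_self:
  fixes p :: "real \<Rightarrow> ennreal"
  assumes "p \<in> borel_measurable borel"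
  shows "(\<integral>\<^sup>+x\<in>{a..a}. p x \<partial>lborel) = 0"
  by (subst nn_integral_0_iff_AE)
     (use assms AE_lborel_singleton[of a] in \<open>auto elim!: eventually_mono\<close>)

lemma nn_integral_Icc_split:
  fixes p :: "real \<Rightarrow> ennreal"
  assumes [measurable]: "p \<in> borel_measurable borel" and "a \<le> b" "b \<le> c"
  shows "(\<integral>\<^sup>+x\<in>{a..c}. p x \<partial>lborel) = (\<integral>\<^sup>+x\<in>{a..b}. p x \<partial>lborel) + (\<integral>\<^sup>+x\<in>{b..c}. p x \<partial>lborel)"
proof -
  have "(\<integral>\<^sup>+x\<in>{a..c}. p x \<partial>lborel) = (\<integral>\<^sup>+x. p x * indicator {a..b} x + p x * indicator {b..c} x \<partial>lborel)"
    by (intro nn_integral_cong_AE, use AE_lborel_singleton[of b] in eventually_elim)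
       (use assms(2,3) in \<open>auto simp: indicator_def\<close>)
  then show ?thesis
    by (simp add: nn_integral_add)
qed

section \<open>Transfer of monotonicity from one quotient to the other\<close>

lemma ennreal_divide_le_divide_iff:
  fixes x y :: ennreal and b c :: real
  assumes "0 < b" "0 < c"
  shows "x / ennreal b \<le> y / ennreal c \<longleftrightarrow> x * ennreal c \<le> y * ennreal b"
  using assms
  by (cases x; cases y)
     (auto simp: divide_ennreal ennreal_mult[symmetric] ennreal_top_divide ennreal_top_mult
        field_simps top_unique)

text \<open>
  In terms of measures, \<open>F_int\<close> and \<open>G_int\<close> say \<open>d(F^2) = 2 F f dx\<close> and \<open>d(G^2) = 2 G v f dx\<close>.  Values
  \<open>\<infinity>\<close> of the integral of \<open>f^2\<close> are allowed; \<open>v_pos\<close> handles them: it keeps the weight \<open>v\<close> away from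
  \<open>0\<close> on an initial interval of positive mass, so an infinite integral of \<open>f^2\<close> there forces the
  integral of \<open>(v f)^2\<close> to be infinite as well.
\<close>
lemma past_square_ratio_transfer:
  fixes F G v r :: "real \<Rightarrow> real" and f :: "real \<Rightarrow> ennreal"
  assumes f[measurable]: "f \<in> borel_measurable borel"
    and mono: "mono F" "mono G" and anti: "antimono v" "antimono r"
    and nonneg: "\<And>x. 0 \<le> F x" "\<And>x. 0 \<le> G x" "\<And>x. 0 \<le> v x" "\<And>x. 0 \<le> r x"
    and F_int: "\<And>u. (\<integral>\<^sup>+x\<in>{0..u}. ennreal (2 * F x) * f x \<partial>lborel) = ennreal ((F u)\<^sup>2)"
    and G_int: "\<And>u. (\<integral>\<^sup>+x\<in>{0..u}. ennreal (2 * G x) * (ennreal (v x) * f x) \<partial>lborel) = ennreal ((G u)\<^sup>2)"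
    and ratio: "\<And>x. F x * v x = r x * G x"
    and v_pos: "\<And>s. 0 < F s \<Longrightarrow> \<exists>u>0. u \<le> s \<and> 0 < F u \<and> 0 < v u"
    and decr: "\<And>a b. 0 < a \<Longrightarrow> a \<le> b \<Longrightarrow> 0 < F a \<Longrightarrow>
      (\<integral>\<^sup>+x\<in>{0..b}. (f x)\<^sup>2 \<partial>lborel) / ennreal ((F b)\<^sup>2)
        \<le> (\<integral>\<^sup>+x\<in>{0..a}. (f x)\<^sup>2 \<partial>lborel) / ennreal ((F a)\<^sup>2)"
    and st: "0 < s" "s \<le> t" "0 < F s" "0 < G s"
  shows "(\<integral>\<^sup>+x\<in>{0..t}. (ennreal (v x) * f x)\<^sup>2 \<partial>lborel) / ennreal ((G t)\<^sup>2)
      \<le> (\<integral>\<^sup>+x\<in>{0..s}. (ennreal (v x) * f x)\<^sup>2 \<partial>lborel) / ennreal ((G s)\<^sup>2)"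
proof -
  have [measurable]: "F \<in> borel_measurable borel" "G \<in> borel_measurable borel"
    using mono by (auto intro: borel_measurable_mono)
  have [measurable]: "v \<in> borel_measurable borel" "r \<in> borel_measurable borel"
    using anti by (auto intro: borel_measurable_antimono)
  define w where "w x = (v x)\<^sup>2" for x
  have w_anti: "antimono w"
    using anti(1) nonneg(3) by (auto simp: w_def monotone_def intro!: power_mono)
  define dF where "dF x = ennreal (2 * F x) * f x" for x
  define dG where "dG x = ennreal (2 * G x) * (ennreal (v x) * f x)" for x
  have [measurable]: "dF \<in> borel_measurable borel" "dG \<in> borel_measurable borel" "w \<in> borel_measurable borel"
    by (simp_all add: dF_def[abs_def] dG_def[abs_def] w_def[abs_def])
  define I where "I A = (\<integral>\<^sup>+x\<in>A. (f x)\<^sup>2 \<partial>lborel)" for A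
  define J where "J A = (\<integral>\<^sup>+x\<in>A. (ennreal (v x) * f x)\<^sup>2 \<partial>lborel)" for A
  have J_w: "J A = (\<integral>\<^sup>+x\<in>A. ennreal (w x) * (f x)\<^sup>2 \<partial>lborel)" for A
    using nonneg(3) by (simp add: J_def w_def power_mult_distrib ennreal_power)
  \<comment> \<open>The change of measure \<open>v^2 d(F^2) = r d(G^2)\<close>, which is where \<open>F v = r G\<close> enters.\<close>
  have w_dF: "ennreal (w x) * dF x = ennreal (r x) * dG x" for x
  proof -
    have "w x * (2 * F x) = r x * (2 * G x) * v x"
      using arg_cong[OF ratio[of x], of "\<lambda>y. 2 * v x * y"] by (simp add: w_def power2_eq_square ac_simps)
    then have "ennreal (w x) * ennreal (2 * F x) = ennreal (r x) * ennreal (2 * G x) * ennreal (v x)"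
      using nonneg by (simp add: ennreal_mult[symmetric] w_def)
    then show ?thesis
      by (simp add: dF_def dG_def mult.assoc[symmetric])
  qed
  have int_w_dF: "(\<integral>\<^sup>+x\<in>A. ennreal (w x) * (h * dF x) \<partial>lborel) = h * (\<integral>\<^sup>+x\<in>A. ennreal (r x) * dG x \<partial>lborel)"
    if [measurable]: "A \<in> sets borel" for A and h :: ennreal
  proof -
    have "ennreal (w x) * (h * dF x) = h * (ennreal (r x) * dG x)" for x
      by (simp add: mult.left_commute[of _ h] w_dF)
    then show ?thesis
      by (simp add: mult.assoc nn_integral_cmult)
  qed
  define h where "h = I {0..s} / ennreal ((F s)\<^sup>2)"
  define c where "c = h * ennreal (r s)"
  have F_pos: "0 < F u" if "s \<le> u" for u
    using monoD[OF mono(1) that] st(3) by simp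
  have h_F: "h * ennreal ((F s)\<^sup>2) = I {0..s}"
    using st(3) by (simp add: h_def ennreal_divide_times)
  \<comment> \<open>Left of \<open>s\<close>, the measure \<open>f^2 dx\<close> dominates \<open>h d(F^2)\<close> on initial intervals; at points
    where \<open>F\<close> vanishes this is trivial and the quotient hypothesis is silent.\<close>
  have before: "h * ennreal ((F u)\<^sup>2) \<le> I {0..u}" if "0 \<le> u" "u \<le> s" for u
  proof (cases "F u = 0 \<or> u = 0")
    case True
    moreover have "ennreal ((F 0)\<^sup>2) = 0"
      by (subst F_int[of 0, symmetric], rule nn_integral_Icc_self) simp
    then have "F 0 = 0"
      by simp
    ultimately show ?thesis
      by auto
  next
    case False
    then have "0 < F u" "0 < u"
      using nonneg(1)[of u] that(1) by simp_all
    then have "h \<le> I {0..u} / ennreal ((F u)\<^sup>2)"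
      unfolding h_def I_def using decr[of u s] that(2) by simp
    then have "h * ennreal ((F u)\<^sup>2) \<le> I {0..u} / ennreal ((F u)\<^sup>2) * ennreal ((F u)\<^sup>2)"
      by (rule mult_right_mono) simp
    also have "\<dots> = I {0..u}"
      using \<open>0 < F u\<close> by (simp add: ennreal_divide_times)
    finally show ?thesis .
  qed
  have int_dF: "(\<integral>\<^sup>+x\<in>{0..u}. h * dF x \<partial>lborel) = h * ennreal ((F u)\<^sup>2)" for u
    by (simp add: mult.assoc nn_integral_cmult F_int[unfolded dF_def[symmetric]])
  have J_s: "c * ennreal ((G s)\<^sup>2) \<le> J {0..s}"
  proof -
    have "c * ennreal ((G s)\<^sup>2) = h * (\<integral>\<^sup>+x\<in>{0..s}. ennreal (r s) * dG x \<partial>lborel)"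
      by (simp add: c_def mult.assoc nn_integral_cmult G_int[unfolded dG_def[symmetric]])
    also have "\<dots> \<le> h * (\<integral>\<^sup>+x\<in>{0..s}. ennreal (r x) * dG x \<partial>lborel)"
      by (intro mult_left_mono nn_integral_mono)
         (auto simp: indicator_def intro!: mult_right_mono ennreal_leI antimonoD[OF anti(2)])
    also have "\<dots> = (\<integral>\<^sup>+x\<in>{0..s}. ennreal (w x) * (h * dF x) \<partial>lborel)"
      by (simp add: int_w_dF)
    also have "\<dots> \<le> J {0..s}"
      unfolding J_w
    proof (rule nn_integral_mono_antimono_weight[OF _ _ w_anti])
      fix u assume "0 \<le> u" "u \<le> s"
      then show "(\<integral>\<^sup>+x\<in>{0..u}. h * dF x \<partial>lborel) \<le> (\<integral>\<^sup>+x\<in>{0..u}. (f x)\<^sup>2 \<partial>lborel)"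
        using before[of u] by (simp add: int_dF I_def)
    qed simp_all
    finally show ?thesis .
  qed
  have G_split: "ennreal ((G t)\<^sup>2) = ennreal ((G s)\<^sup>2) + (\<integral>\<^sup>+x\<in>{s..t}. dG x \<partial>lborel)"
    using nn_integral_Icc_split[of dG 0 s t] st by (simp add: G_int[unfolded dG_def[symmetric]])
  have J_split: "J {0..t} = J {0..s} + J {s..t}"
    unfolding J_def using st by (intro nn_integral_Icc_split) auto
  have "J {0..t} * ennreal ((G s)\<^sup>2) \<le> J {0..s} * ennreal ((G t)\<^sup>2)"
  proof (cases "h = top")
    case True
    obtain u where u: "0 < u" "u \<le> s" "0 < F u" "0 < v u"
      using v_pos[OF st(3)] by auto
    have "top = I {0..u}"
      using before[of u] u True by (simp add: ennreal_top_mult top_unique)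
    then have "top = (\<integral>\<^sup>+x\<in>{0..u}. ennreal (w u) * (f x)\<^sup>2 \<partial>lborel)"
      using u by (simp add: I_def mult.assoc nn_integral_cmult ennreal_mult_top w_def flip: I_def)
    also have "\<dots> \<le> J {0..s}"
      unfolding J_w using u(2)
      by (intro nn_integral_mono)
         (auto simp: indicator_def intro!: mult_right_mono ennreal_leI antimonoD[OF w_anti])
    finally have "J {0..s} = top"
      by (simp add: top_unique)
    moreover have "0 < G t"
      using monoD[OF mono(2) st(2)] st(4) by simp
    ultimately show ?thesis
      by (simp add: ennreal_top_mult)
  next
    case False
    have I_s: "I {0..s} \<noteq> top"
      using False h_F by (metis ennreal_mult_eq_top_iff ennreal_neq_top)
    \<comment> \<open>Right of \<open>s\<close> the comparison is reversed: at \<open>s\<close> itself \<open>I\<close> and \<open>h F^2\<close> coincide, and being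
      finite they cancel.\<close>
    have after: "I {s..u} \<le> (\<integral>\<^sup>+x\<in>{s..u}. h * dF x \<partial>lborel)" if "s \<le> u" for u
    proof -
      have "I {0..u} / ennreal ((F u)\<^sup>2) \<le> h"
        unfolding h_def I_def using decr[of s u] that st by simp
      then have "I {0..u} / ennreal ((F u)\<^sup>2) * ennreal ((F u)\<^sup>2) \<le> h * ennreal ((F u)\<^sup>2)"
        by (rule mult_right_mono) simp
      then have "I {0..u} \<le> h * ennreal ((F u)\<^sup>2)"
        using F_pos[OF that] by (simp add: ennreal_divide_times)
      also have "\<dots> = I {0..s} + (\<integral>\<^sup>+x\<in>{s..u}. h * dF x \<partial>lborel)"
        using nn_integral_Icc_split[of "\<lambda>x. h * dF x" 0 s u] that st(1) by (simp add: int_dF h_F)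
      finally have "I {0..s} + I {s..u} \<le> I {0..s} + (\<integral>\<^sup>+x\<in>{s..u}. h * dF x \<partial>lborel)"
        using nn_integral_Icc_split[of "\<lambda>x. (f x)\<^sup>2" 0 s u] that st(1) by (simp add: I_def)
      then show ?thesis
        using I_s by (simp add: ennreal_add_left_cancel_le)
    qed
    have "J {s..t} \<le> (\<integral>\<^sup>+x\<in>{s..t}. ennreal (w x) * (h * dF x) \<partial>lborel)"
      unfolding J_w
      by (rule nn_integral_mono_antimono_weight[OF _ _ w_anti]) (use after in \<open>simp_all add: I_def\<close>)
    also have "\<dots> = h * (\<integral>\<^sup>+x\<in>{s..t}. ennreal (r x) * dG x \<partial>lborel)"
      by (simp add: int_w_dF)
    also have "\<dots> \<le> h * (\<integral>\<^sup>+x\<in>{s..t}. ennreal (r s) * dG x \<partial>lborel)"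
      by (intro mult_left_mono nn_integral_mono)
         (auto simp: indicator_def intro!: mult_right_mono ennreal_leI antimonoD[OF anti(2)])
    also have "\<dots> = c * (\<integral>\<^sup>+x\<in>{s..t}. dG x \<partial>lborel)"
      by (simp add: c_def mult.assoc nn_integral_cmult)
    finally have "J {s..t} * ennreal ((G s)\<^sup>2) \<le> c * (\<integral>\<^sup>+x\<in>{s..t}. dG x \<partial>lborel) * ennreal ((G s)\<^sup>2)"
      by (rule mult_right_mono) simp
    also have "\<dots> = c * ennreal ((G s)\<^sup>2) * (\<integral>\<^sup>+x\<in>{s..t}. dG x \<partial>lborel)"
      by (simp add: ac_simps)
    also have "\<dots> \<le> J {0..s} * (\<integral>\<^sup>+x\<in>{s..t}. dG x \<partial>lborel)"
      by (intro mult_right_mono J_s) simp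
    finally show ?thesis
      by (simp add: J_split G_split distrib_left distrib_right add_left_mono)
  qed
  moreover have "0 < G t"
    using monoD[OF mono(2) st(2)] st(4) by simp
  ultimately show ?thesis
    unfolding J_def using st(4) by (simp add: ennreal_divide_le_divide_iff)
qed

section \<open>Monotonicity of the ratio of reversed hazard rates\<close>

text \<open>
  Divided by \<open>y ^ (n - 1)\<close>, the denominator becomes a sum of non-positive powers of \<open>y\<close>, so it
  decreases in \<open>y\<close>.  The proof clears denominators to include \<open>y = 0\<close>.
\<close>
lemma last_term_over_geometric_sum_mono:
  fixes y z :: real
  assumes "1 \<le> n" "0 \<le> y" "y \<le> z"
  shows "y ^ (n - 1) / (\<Sum>k<n. y ^ k) \<le> z ^ (n - 1) / (\<Sum>k<n. z ^ k)"
proof -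
  have pos: "0 < (\<Sum>k<n. x ^ k)" if "0 \<le> x" for x :: real
    using that assms(1) by (intro sum_pos2[of _ 0]) auto
  have "y ^ (n - 1) * (\<Sum>k<n. z ^ k) \<le> z ^ (n - 1) * (\<Sum>k<n. y ^ k)"
    unfolding sum_distrib_left
  proof (rule sum_mono)
    fix k assume "k \<in> {..<n}"
    then have *: "x ^ (n - 1) = x ^ k * x ^ (n - 1 - k)" for x :: real
      by (simp flip: power_add)
    have "y ^ (n - 1 - k) * (y ^ k * z ^ k) \<le> z ^ (n - 1 - k) * (y ^ k * z ^ k)"
      using assms by (intro mult_right_mono power_mono) auto
    then show "y ^ (n - 1) * z ^ k \<le> z ^ (n - 1) * y ^ k"
      unfolding *[of y] *[of z] by (simp only: ac_simps)
  qed
  then show ?thesis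
    using pos[of y] pos[of z] assms by (simp add: divide_simps mult.commute)
qed


section \<open>Integrating functions of the distribution function\<close>

text \<open>
  The quantile function \<open>I\<close> maps Lebesgue measure on \<open>(0, 1)\<close> to the given law, and without atoms it is a
  right inverse of the distribution function.  Substituting \<open>x = I \<omega>\<close> therefore replaces \<open>C x\<close> by
  \<open>\<omega>\<close> and \<open>x \<le> u\<close> by \<open>\<omega> \<le> C u\<close>, which leaves an ordinary integral over \<open>[0, C u]\<close>.
\<close>
lemma (in cdf_distribution) nn_integral_atomless_cdf:
  fixes \<psi> \<Psi> :: "real \<Rightarrow> real"
  assumes atomless: "\<And>x. measure M {x} = 0"
    and [measurable]: "\<psi> \<in> borel_measurable borel"
    and nonneg: "\<And>y. 0 \<le> y \<Longrightarrow> y \<le> 1 \<Longrightarrow> 0 \<le> \<psi> y"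
    and deriv: "\<And>y. 0 \<le> y \<Longrightarrow> y \<le> 1 \<Longrightarrow> (\<Psi> has_real_derivative \<psi> y) (at y)"
  shows "(\<integral>\<^sup>+x\<in>{..u}. ennreal (\<psi> (C x)) \<partial>M) = ennreal (\<Psi> (C u) - \<Psi> 0)"
proof -
  let ?\<Omega> = "restrict_space lborel {0<..<1::real}"
  have [measurable]: "I \<in> borel_measurable ?\<Omega>"
    using measurable_CI by (simp cong: measurable_cong_sets add: measurable_restrict_space1 sets_restrict_space_cong[of lborel borel])
  have C_I: "C (I \<omega>) = \<omega>" if "0 < \<omega>" "\<omega> < 1" for \<omega>
  proof (rule antisym)
    have "((\<lambda>x. C x) \<longlongrightarrow> C (I \<omega>)) (at_left (I \<omega>))"
      using isCont_cdf[of "I \<omega>"] atomless by (simp add: isCont_def filterlim_at_split)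
    moreover have "eventually (\<lambda>x. C x \<le> \<omega>) (at_left (I \<omega>))"
      unfolding eventually_at_filter
    proof (intro always_eventually allI impI)
      fix x assume "x \<in> {..<I \<omega>}"
      then show "C x \<le> \<omega>"
        using pseudoinverse[OF that, of x] by auto
    qed
    ultimately show "C (I \<omega>) \<le> \<omega>"
      by (rule tendsto_upperbound) simp
    show "\<omega> \<le> C (I \<omega>)"
      using pseudoinverse[OF that, of "I \<omega>"] by blast
  qed
  have "(\<integral>\<^sup>+x\<in>{..u}. ennreal (\<psi> (C x)) \<partial>M)
      = (\<integral>\<^sup>+x\<in>{..u}. ennreal (\<psi> (C x)) \<partial>(distr ?\<Omega> borel I))"
    by (simp add: distr_I_eq_M)
  also have "\<dots> = (\<integral>\<^sup>+\<omega>. ennreal (\<psi> (C (I \<omega>))) * indicator {..u} (I \<omega>) \<partial>?\<Omega>)"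
    by (subst nn_integral_distr) auto
  also have "\<dots> = (\<integral>\<^sup>+\<omega>\<in>{0<..<1}. ennreal (\<psi> (C (I \<omega>))) * indicator {..u} (I \<omega>) \<partial>lborel)"
    by (subst nn_integral_restrict_space) auto
  also have "\<dots> = (\<integral>\<^sup>+\<omega>\<in>{0..C u}. ennreal (\<psi> \<omega>) \<partial>lborel)"
  proof (rule nn_integral_cong_AE)
    show "AE \<omega> in lborel. ennreal (\<psi> (C (I \<omega>))) * indicator {..u} (I \<omega>) * indicator {0<..<1} \<omega>
        = ennreal (\<psi> \<omega>) * indicator {0..C u} \<omega>"
      using AE_lborel_singleton[of "0::real"] AE_lborel_singleton[of "1::real"]
    proof eventually_elim
      case (elim \<omega>)
      then show ?case
        using C_I[of \<omega>] pseudoinverse[of \<omega> u] cdf_bounded_prob[of u]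
        by (auto simp: indicator_def)
    qed
  qed
  also have "\<dots> = ennreal (\<Psi> (C u) - \<Psi> 0)"
    using cdf_bounded_prob[of u] cdf_nonneg[of u]
    by (intro nn_integral_FTC_Icc) (auto intro!: nonneg DERIV_subset[OF deriv])
  finally show ?thesis .
qed

lemma emeasure_density_singleton:
  fixes f :: "real \<Rightarrow> ennreal"
  assumes [measurable]: "f \<in> borel_measurable borel"
  shows "emeasure (density lborel f) {x} = 0"
proof -
  have "AE y in lborel. f y * indicator {x} y = 0"
    using AE_lborel_singleton[of x] by eventually_elim auto
  then show ?thesis
    by (simp add: emeasure_density nn_integral_0_iff_AE)
qed

lemma nn_integral_cdf_density:
  fixes f :: "real \<Rightarrow> ennreal" and \<psi> \<Psi> :: "real \<Rightarrow> real"
  assumes P: "real_distribution P" "P = density lborel f"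
    and [measurable]: "f \<in> borel_measurable borel" "\<psi> \<in> borel_measurable borel"
    and nonneg: "\<And>y. 0 \<le> y \<Longrightarrow> y \<le> 1 \<Longrightarrow> 0 \<le> \<psi> y"
    and deriv: "\<And>y. 0 \<le> y \<Longrightarrow> y \<le> 1 \<Longrightarrow> (\<Psi> has_real_derivative \<psi> y) (at y)"
  shows "(\<integral>\<^sup>+x\<in>{..u}. ennreal (\<psi> (cdf P x)) * f x \<partial>lborel) = ennreal (\<Psi> (cdf P u) - \<Psi> 0)"
proof -
  interpret cdf_distribution P
    using P(1) by (simp add: cdf_distribution_def)
  have "measure P {x} = 0" for x
    by (simp add: P(2) measure_def emeasure_density_singleton)
  then have "(\<integral>\<^sup>+x\<in>{..u}. ennreal (\<psi> (C x)) \<partial>P) = ennreal (\<Psi> (C u) - \<Psi> 0)"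
    by (intro nn_integral_atomless_cdf nonneg deriv) auto
  moreover have "(\<integral>\<^sup>+x\<in>{..u}. ennreal (\<psi> (C x)) \<partial>P) = (\<integral>\<^sup>+x\<in>{..u}. ennreal (\<psi> (C x)) * f x \<partial>lborel)"
  proof -
    have "(\<integral>\<^sup>+x\<in>{..u}. ennreal (\<psi> (C x)) \<partial>density lborel f)
        = (\<integral>\<^sup>+x. f x * (ennreal (\<psi> (C x)) * indicator {..u} x) \<partial>lborel)"
      by (rule nn_integral_density) auto
    then show ?thesis
      by (simp add: P(2)[symmetric] ac_simps)
  qed
  ultimately show ?thesis
    by simp
qed

lemma nn_integral_Icc_eq_atMost:
  fixes f k :: "real \<Rightarrow> ennreal"
  assumes "AE x in density lborel f. 0 \<le> x" and [measurable]: "f \<in> borel_measurable borel"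
  shows "(\<integral>\<^sup>+x\<in>{0..u}. k x * f x \<partial>lborel) = (\<integral>\<^sup>+x\<in>{..u}. k x * f x \<partial>lborel)"
proof (rule nn_integral_cong_AE)
  have "AE x in lborel. 0 < f x \<longrightarrow> 0 \<le> x"
    using assms by (simp add: AE_density)
  then show "AE x in lborel. k x * f x * indicator {0..u} x = k x * f x * indicator {..u} x"
    by eventually_elim (auto simp: indicator_def zero_less_iff_neq_zero)
qed

lemma nn_integral_twice_cdf_density:
  fixes f :: "real \<Rightarrow> ennreal"
  assumes P: "real_distribution P" "P = density lborel f" and pos: "AE x in P. 0 \<le> x"
    and f: "f \<in> borel_measurable borel"
  shows "(\<integral>\<^sup>+x\<in>{0..u}. ennreal (2 * cdf P x) * f x \<partial>lborel) = ennreal ((cdf P u)\<^sup>2)"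
proof -
  have "((\<lambda>y. y\<^sup>2) has_real_derivative 2 * y) (at y)" for y :: real
    by (auto intro!: derivative_eq_intros)
  then show ?thesis
    using nn_integral_cdf_density[OF P f, of "\<lambda>y. 2 * y" "\<lambda>y. y\<^sup>2" u]
    by (subst nn_integral_Icc_eq_atMost[OF pos[unfolded P(2)] f]) auto
qed

section \<open>The law of the minimum\<close>

lemma (in prob_space) cdf_distr_Min:
  fixes Y :: "'i \<Rightarrow> 'a \<Rightarrow> real"
  assumes indep: "indep_vars (\<lambda>_. borel) Y A" and A: "finite A" "A \<noteq> {}"
    and law: "\<And>i. i \<in> A \<Longrightarrow> distr M borel (Y i) = P"
  shows "cdf (distr M borel (\<lambda>\<omega>. Min ((\<lambda>i. Y i \<omega>) ` A))) u = 1 - (1 - cdf P u) ^ card A"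
proof -
  have [measurable]: "Y i \<in> borel_measurable M" if "i \<in> A" for i
    using indep that by (auto simp: indep_vars_def)
  let ?Z = "\<lambda>\<omega>. Min ((\<lambda>i. Y i \<omega>) ` A)"
  have [measurable]: "?Z \<in> borel_measurable M"
    using A by (intro borel_measurable_Min) auto
  have tail: "prob (Y i -` {u<..} \<inter> space M) = 1 - cdf P u" if "i \<in> A" for i
  proof -
    have "cdf P u = prob (Y i -` {..u} \<inter> space M)"
      using that by (simp add: cdf_def law[symmetric] measure_distr)
    also have "Y i -` {..u} \<inter> space M = space M - (Y i -` {u<..} \<inter> space M)"
      by auto
    finally show ?thesis
      using that by (simp add: prob_compl)
  qed
  have Z_le: "?Z \<omega> \<le> u \<longleftrightarrow> \<not> (\<forall>i\<in>A. u < Y i \<omega>)" for \<omega>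
    using A by (subst Min_le_iff) (auto simp: not_less)
  have "?Z -` {..u} \<inter> space M = space M - (\<Inter>i\<in>A. Y i -` {u<..} \<inter> space M)"
    using A(2) by (auto simp: Z_le)
  then have "cdf (distr M borel ?Z) u = prob (space M - (\<Inter>i\<in>A. Y i -` {u<..} \<inter> space M))"
    by (simp add: cdf_def measure_distr)
  also have "\<dots> = 1 - prob (\<Inter>i\<in>A. Y i -` {u<..} \<inter> space M)"
    using A by (intro prob_compl sets.finite_INT) auto
  also have "prob (\<Inter>i\<in>A. Y i -` {u<..} \<inter> space M) = (\<Prod>i\<in>A. prob (Y i -` {u<..} \<inter> space M))"
    using A by (intro indep_varsD_finite[OF indep]) auto
  also have "\<dots> = (1 - cdf P u) ^ card A"
    by (simp add: tail)
  finally show ?thesis .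
qed

text \<open>
  The candidate density has the right distribution function by lemma \<open>nn_integral_cdf_density\<close> applied to
  the derivative of \<open>y \<mapsto> 1 - (1 - y)^n\<close>; the bound \<open>n (1 - F)^(n-1) \<le> n\<close> makes the candidate measure finite, so
  that its distribution function determines it.
\<close>
lemma density_of_min_cdf:
  fixes f :: "real \<Rightarrow> ennreal"
  assumes P: "real_distribution P" "P = density lborel f" and Q: "real_distribution Q"
    and [measurable]: "f \<in> borel_measurable borel"
    and cdf: "\<And>u. cdf Q u = 1 - (1 - cdf P u) ^ n"
  shows "Q = density lborel (\<lambda>x. ennreal (real n * (1 - cdf P x) ^ (n - 1)) * f x)"
proof -
  interpret P: cdf_distribution P
    using P(1) by (simp add: cdf_distribution_def)
  interpret Q: real_distribution Q
    by (rule Q)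
  let ?g = "\<lambda>x. ennreal (real n * (1 - cdf P x) ^ (n - 1)) * f x"
  have em: "emeasure (density lborel ?g) {..u} = ennreal (cdf Q u)" for u
  proof -
    have "emeasure (density lborel ?g) {..u} = (\<integral>\<^sup>+x\<in>{..u}. ?g x \<partial>lborel)"
      by (subst emeasure_density) auto
    also have "\<dots> = ennreal ((1 - (1 - cdf P u) ^ n) - (1 - (1 - 0) ^ n))"
      by (rule nn_integral_cdf_density[OF P]) (auto intro!: derivative_eq_intros)
    finally show ?thesis
      by (simp add: cdf)
  qed
  have "emeasure (density lborel ?g) (space (density lborel ?g)) \<le> (\<integral>\<^sup>+x. ennreal (real n) * f x \<partial>lborel)"
    using P.cdf_bounded_prob P.cdf_nonneg
    by (subst emeasure_density)
       (auto intro!: nn_integral_mono mult_right_mono ennreal_leI mult_left_le power_le_one)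
  also have "\<dots> = ennreal (real n) * emeasure P (space P)"
    by (simp add: nn_integral_cmult P(2) emeasure_density)
  also have "\<dots> < top"
    using P.emeasure_space_1 by (simp add: ennreal_mult_less_top)
  finally have "finite_borel_measure (density lborel ?g)"
    by (intro finite_borel_measure.intro finite_measureI finite_borel_measure_axioms.intro) auto
  moreover have "cdf Q = cdf (density lborel ?g)"
    unfolding cdf_def[of "density lborel ?g"] measure_def em by (simp add: Q.cdf_nonneg)
  ultimately show ?thesis
    by (intro cdf_unique' Q.finite_borel_measure_M)
qed

section \<open>Past extropy and the preservation theorem\<close>

lemma past_extropy_density:
  fixes f :: "real \<Rightarrow> ennreal"
  assumes "distr M borel Z = density lborel f" and [measurable]: "f \<in> borel_measurable borel"
  shows "past_extropy M Z t
    = - ereal (1 / 2) * enn2ereal ((\<integral>\<^sup>+x\<in>{0..t}. (f x)\<^sup>2 \<partial>lborel) / ennreal ((cdf (distr M borel Z) t)\<^sup>2))"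
proof -
  let ?H = "cdf (distr M borel Z) t"
  have "AE x in lborel. f x = RN_deriv lborel (distr M borel Z) x"
    by (rule sigma_finite_measure.RN_deriv_unique[OF sigma_finite_lborel]) (simp_all add: assms(1))
  then have "(\<integral>\<^sup>+x\<in>{0..t}. (RN_deriv lborel (distr M borel Z) x / ennreal ?H)\<^sup>2 \<partial>lborel)
      = (\<integral>\<^sup>+x. ((f x)\<^sup>2 * indicator {0..t} x) / ennreal (?H\<^sup>2) \<partial>lborel)"
    by (intro nn_integral_cong_AE, eventually_elim)
       (auto simp: power_divide_distrib_ennreal ennreal_power cdf_def indicator_def)
  also have "\<dots> = (\<integral>\<^sup>+x\<in>{0..t}. (f x)\<^sup>2 \<partial>lborel) / ennreal (?H\<^sup>2)"
    by (rule nn_integral_divide) simp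
  finally show ?thesis
    by (simp add: past_extropy_def)
qed

lemma neg_half_enn2ereal_le_iff:
  "- ereal (1 / 2) * enn2ereal a \<le> - ereal (1 / 2) * enn2ereal b \<longleftrightarrow> b \<le> a"
  by (cases a; cases b) (auto simp: top_unique top_ereal_def)

lemma past_extropy_density_le_iff:
  fixes f :: "real \<Rightarrow> ennreal"
  assumes "distr M borel Z = density lborel f" and "f \<in> borel_measurable borel"
  shows "past_extropy M Z s \<le> past_extropy M Z t \<longleftrightarrow>
    (\<integral>\<^sup>+x\<in>{0..t}. (f x)\<^sup>2 \<partial>lborel) / ennreal ((cdf (distr M borel Z) t)\<^sup>2)
      \<le> (\<integral>\<^sup>+x\<in>{0..s}. (f x)\<^sup>2 \<partial>lborel) / ennreal ((cdf (distr M borel Z) s)\<^sup>2)"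
  unfolding past_extropy_density[OF assms] by (rule neg_half_enn2ereal_le_iff)

theorem theorem4p3:
  fixes M :: "'a measure" and X :: "'a \<Rightarrow> real"
    and N :: "'b measure" and Y :: "nat \<Rightarrow> 'b \<Rightarrow> real"
    and n :: nat
  assumes "prob_space M"
    and "nonneg_abs_cont M X"
    and "n \<ge> 1"
    and "prob_space N"
    and "prob_space.indep_vars N (\<lambda>_. borel) Y {1..n}"
    and "\<And>i. i \<in> {1..n} \<Longrightarrow> distr N borel (Y i) = distr M borel X"
    and "IPEX M X"
  shows "IPEX N (\<lambda>\<omega>. Min ((\<lambda>i. Y i \<omega>) ` {1..n}))"
proof -
  interpret M: prob_space M by (rule assms(1))
  interpret N: prob_space N by (rule assms(4))
  let ?Z = "\<lambda>\<omega>. Min ((\<lambda>i. Y i \<omega>) ` {1..n})"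
  define P where "P = distr M borel X"
  define Q where "Q = distr N borel ?Z"
  define f where "f = RN_deriv lborel P"
  define F where "F = cdf P"
  define v where "v x = real n * (1 - F x) ^ (n - 1)" for x
  define r where "r x = real n * ((1 - F x) ^ (n - 1) / (\<Sum>k<n. (1 - F x) ^ k))" for x
  have [measurable]: "X \<in> borel_measurable M" and X_nonneg: "AE \<omega> in M. 0 \<le> X \<omega>"
    and ac: "absolutely_continuous lborel P"
    using assms(2) by (auto simp: nonneg_abs_cont_def P_def)
  have [measurable]: "Y i \<in> borel_measurable N" if "i \<in> {1..n}" for i
    using assms(5) that by (auto simp: N.indep_vars_def)
  have Z_meas[measurable]: "?Z \<in> borel_measurable N"
    using assms(3) by (intro borel_measurable_Min) auto
  have f[measurable]: "f \<in> borel_measurable borel"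
    using borel_measurable_RN_deriv[of lborel P] by (simp add: f_def)
  have P: "real_distribution P" "P = density lborel f"
    using sigma_finite_measure.density_RN_deriv[OF sigma_finite_lborel ac] by (auto simp: P_def f_def M.real_distribution_distr)
  have Q: "real_distribution Q"
    by (simp add: Q_def N.real_distribution_distr)
  interpret P: cdf_distribution P
    using P(1) by (simp add: cdf_distribution_def)
  interpret Q: cdf_distribution Q
    using Q by (simp add: cdf_distribution_def)
  have F01: "0 \<le> F x" "F x \<le> 1" for x
    using P.cdf_nonneg P.cdf_bounded_prob by (auto simp: F_def)
  have G: "cdf Q u = 1 - (1 - F u) ^ n" for u
    using N.cdf_distr_Min[OF assms(5) _ _ assms(6), of u] assms(3) by (simp add: Q_def F_def P_def)
  have Q_density: "Q = density lborel (\<lambda>x. ennreal (v x) * f x)"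
    using density_of_min_cdf[OF P Q f, of n] G by (simp add: v_def F_def)
  have F_mono: "mono F"
    using P.mono by (simp add: F_def)
  have v_anti: "antimono v"
    using F01 F_mono by (auto simp: v_def monotone_def intro!: mult_left_mono power_mono)
  have r_anti: "antimono r"
    unfolding r_def using F01 F_mono assms(3)
    by (intro monotoneI mult_left_mono last_term_over_geometric_sum_mono) (auto simp: monotone_def)
  have [measurable]: "v \<in> borel_measurable borel"
    using v_anti by (rule borel_measurable_antimono)
  have P_pos: "AE x in P. 0 \<le> x"
    unfolding P_def using X_nonneg by (subst AE_distr_iff) auto
  have Q_pos: "AE x in Q. 0 \<le> x"
  proof -
    have "AE x in lborel. 0 < f x \<longrightarrow> 0 \<le> x"
      using P_pos[unfolded P(2)] by (subst (asm) AE_density) auto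
    then have "AE x in lborel. 0 < ennreal (v x) * f x \<longrightarrow> 0 \<le> x"
      by eventually_elim (auto simp: ennreal_zero_less_mult_iff)
    then show ?thesis
      unfolding Q_density by (subst AE_density) auto
  qed
  have ratio: "F x * v x = r x * cdf Q x" for x
  proof -
    have "0 < (\<Sum>k<n. (1 - F x) ^ k)"
      using assms(3) F01 by (intro sum_pos2[of _ 0]) auto
    moreover have "cdf Q x = F x * (\<Sum>k<n. (1 - F x) ^ k)"
      using one_diff_power_eq[of "1 - F x" n] by (simp add: G)
    ultimately show ?thesis
      by (simp add: v_def r_def)
  qed
  have F_0: "F 0 = 0"
  proof -
    have "ennreal ((F 0)\<^sup>2) = (\<integral>\<^sup>+x\<in>{0..0}. ennreal (2 * F x) * f x \<partial>lborel)"
      unfolding F_def by (rule nn_integral_twice_cdf_density[OF P P_pos f, symmetric])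
    also have "\<dots> = 0"
      by (rule nn_integral_Icc_self) (simp add: F_def)
    finally show ?thesis
      by simp
  qed
  have decr: "(\<integral>\<^sup>+x\<in>{0..b}. (f x)\<^sup>2 \<partial>lborel) / ennreal ((F b)\<^sup>2)
        \<le> (\<integral>\<^sup>+x\<in>{0..a}. (f x)\<^sup>2 \<partial>lborel) / ennreal ((F a)\<^sup>2)"
    if ab: "0 < a" "a \<le> b" "0 < F a" for a b
  proof -
    have "0 < F b"
      using monoD[OF F_mono ab(2)] ab(3) by simp
    then have "past_extropy M X a \<le> past_extropy M X b"
      using assms(7) ab by (auto simp: IPEX_def P_def F_def intro: mono_onD)
    then show ?thesis
      unfolding past_extropy_density_le_iff[OF P(2)[unfolded P_def] f] F_def P_def .
  qed
  show ?thesis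
    unfolding IPEX_def
  proof
    show "nonneg_abs_cont N ?Z"
      unfolding nonneg_abs_cont_def Q_def[symmetric]
    proof (intro conjI Z_meas)
      show "AE \<omega> in N. 0 \<le> ?Z \<omega>"
        using Q_pos unfolding Q_def by (subst (asm) AE_distr_iff) auto
      show "absolutely_continuous lborel Q"
        unfolding Q_density by (rule absolutely_continuousI_density) simp
    qed
    show "mono_on {t. 0 < t \<and> 0 < cdf (distr N borel ?Z) t} (past_extropy N ?Z)"
      unfolding Q_def[symmetric]
    proof (rule mono_onI, clarify)
      fix s t :: real
      assume st: "0 < s" "s \<le> t" "0 < cdf Q s"
      have "0 < F s"
        using st(3) F01[of s] by (cases "F s = 0") (auto simp: G)
      have v_pos: "\<exists>u>0. u \<le> s \<and> 0 < F u \<and> 0 < v u" if Fs: "0 < F s" for s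
      proof -
        have "0 < s"
          using Fs F_0 monoD[OF F_mono, of s 0] by (cases "0 < s") auto
        \<comment> \<open>Since \<open>F\<close> is continuous it takes the value \<open>F s / 2\<close>, which is below 1 even if \<open>F s = 1\<close>.\<close>
        have "measure P {x} = 0" for x
          by (simp add: P(2) measure_def emeasure_density_singleton)
        then have "continuous_on {0..s} F"
          unfolding F_def by (intro continuous_at_imp_continuous_on ballI) (simp add: P.isCont_cdf)
        then obtain u where u: "0 \<le> u" "u \<le> s" "F u = F s / 2"
          using IVT'[of F 0 "F s / 2" s] \<open>0 < s\<close> Fs F_0 by auto
        have "u \<noteq> 0"
          using u(3) Fs F_0 by auto
        moreover have "0 < v u"
          using u(3) F01(2)[of s] assms(3) by (simp add: v_def)
        ultimately show ?thesis
          using u Fs by (intro exI[of _ u]) auto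
      qed
      have "(\<integral>\<^sup>+x\<in>{0..t}. (ennreal (v x) * f x)\<^sup>2 \<partial>lborel) / ennreal ((cdf Q t)\<^sup>2)
          \<le> (\<integral>\<^sup>+x\<in>{0..s}. (ennreal (v x) * f x)\<^sup>2 \<partial>lborel) / ennreal ((cdf Q s)\<^sup>2)"
      proof (rule past_square_ratio_transfer[OF f F_mono Q.mono v_anti r_anti _ _ _ _ _ _ ratio v_pos decr st(1,2) \<open>0 < F s\<close> st(3)])
        show "(\<integral>\<^sup>+x\<in>{0..u}. ennreal (2 * F x) * f x \<partial>lborel) = ennreal ((F u)\<^sup>2)" for u
          unfolding F_def by (rule nn_integral_twice_cdf_density[OF P P_pos f])
        show "(\<integral>\<^sup>+x\<in>{0..u}. ennreal (2 * cdf Q x) * (ennreal (v x) * f x) \<partial>lborel) = ennreal ((cdf Q u)\<^sup>2)" for u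
          by (rule nn_integral_twice_cdf_density[OF Q Q_density Q_pos]) simp
      qed (use F01 in \<open>auto simp: v_def r_def Q.cdf_nonneg intro!: mult_nonneg_nonneg divide_nonneg_nonneg sum_nonneg\<close>)
      then show "past_extropy N ?Z s \<le> past_extropy N ?Z t"
        unfolding Q_def by (subst past_extropy_density_le_iff[OF Q_density[unfolded Q_def]]) simp_all
    qed
  qed
qed

end
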